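(* For $p\ge2$ let the constants $\alpha_j^p$, $j=1,\dots,p-1$, be defined recursively by $\alpha_1^2=\frac12$, $\alpha_1^3=3$, $\alpha_2^3=-\frac12$ and, for $q\ge3$, $$\alpha_1^{q+1}=\tfrac{q^2}{2}+2\alpha_1^q-\alpha_1^{q-1},\qquad \alpha_j^{q+1}=2\alpha_j^q-\alpha_j^{q-1}-\alpha_{j-1}^q\ \ (2\le j\le q-2),$$ $$\alpha_{q-1}^{q+1}=2\alpha_{q-1}^q-\alpha_{q-2}^q,\qquad \alpha_q^{q+1}=-\alpha_{q-1}^q.$$ Then $$\alpha_j^p=\frac{\prod_{\ell=0}^{j}(\ell^2-p^2)}{(2j+2)!},\qquad 1\le j\le p-1,\quad p\ge2.$$ Moreover, for $p\ge 2$ and $\kappa\in[0,4p^2]$, $$\Big|\frac{2}{p^2}\sum_{j=1}^{p-1}\alpha_j^p\Big(\frac{\kappa}{p^2}\Big)^{j}\Big|\le\frac{\kappa}{12}\qquad\text{and}\qquad \Big|\frac{2}{p^2}\sum_{j=1}^{p-1}\alpha_j^p\Big(\frac{\kappa}{p^2}\Big)^{j-1}\Big|\le\frac{p^2-1}{12}.$$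
   Context: All $\alpha_j^p$ are real numbers indexed by integers $p\ge2$ and $1\le j\le p-1$; the convention $0^0=1$ is used when $\kappa=0$. *)

theory Defs
  imports Complex_Main
begin

text \<open>
  The argument order is \<open>alpha p j\<close> for $\alpha_j^p$. The value is 0 outside the index range
  $1 \le j \le p-1$, $p \ge 2$; no equation of the recursion refers to such an index.
\<close>

function alpha :: "nat \<Rightarrow> nat \<Rightarrow> real" where
  "alpha p j =
    (if p < 2 \<or> j < 1 \<or> p - 1 < j then 0
     else if p = 2 then 1 / 2
     else if p = 3 then (if j = 1 then 3 else - 1 / 2)
     else let q = p - 1 in
       if j = 1 then (real q)\<^sup>2 / 2 + 2 * alpha q 1 - alpha (q - 1) 1
       else if j \<le> q - 2 then 2 * alpha q j - alpha (q - 1) j - alpha q (j - 1)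
       else if j = q - 1 then 2 * alpha q (q - 1) - alpha q (q - 2)
       else - alpha q (q - 1))"
  by pat_completeness auto
termination by (relation "measure fst") auto

declare alpha.simps [simp del]

lemma alpha_base:
  "alpha 2 1 = 1 / 2" "alpha 3 1 = 3" "alpha 3 2 = - 1 / 2"
  by (simp_all add: alpha.simps)

lemma alpha_rec_first:
  "q \<ge> 3 \<Longrightarrow> alpha (q + 1) 1 = (real q)\<^sup>2 / 2 + 2 * alpha q 1 - alpha (q - 1) 1"
  by (subst alpha.simps) (auto simp: Let_def)

lemma alpha_rec_middle:
  "q \<ge> 3 \<Longrightarrow> 2 \<le> j \<Longrightarrow> j \<le> q - 2 \<Longrightarrow>
    alpha (q + 1) j = 2 * alpha q j - alpha (q - 1) j - alpha q (j - 1)"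
  by (subst alpha.simps) (auto simp: Let_def)

lemma alpha_rec_penultimate:
  "q \<ge> 3 \<Longrightarrow> alpha (q + 1) (q - 1) = 2 * alpha q (q - 1) - alpha q (q - 2)"
  by (subst alpha.simps) (auto simp: Let_def)

lemma alpha_rec_last:
  "q \<ge> 3 \<Longrightarrow> alpha (q + 1) q = - alpha q (q - 1)"
  by (subst alpha.simps) (auto simp: Let_def)

end

theory Submission
  imports Defs
begin

text \<open>
  With $F_p(x) = \sum_{j \ge 1} \alpha_j^p x^{j-1}$ the recursion becomes
  $F_{q+1} - 2 F_q + F_{q-1} = D_q / 2$, where $D_q = q^2 - 2 x F_q$. For $x = 2 - 2\cos\theta$ the
  cosine addition theorem turns this into $x D_q = 2 - 2\cos(q\theta)$, so $D_q \ge 0$ on $[0,4]$.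
  Hence $F_q$ is convex in $q$ and nonnegative, which in turn gives $D_q \le q^2$; summing the second
  differences twice yields $0 \le F_p \le p^2(p^2-1)/24$, and both estimates follow.
\<close>

section \<open>The closed form and its recursion in \<open>p\<close>\<close>

definition alpha_closed :: "real \<Rightarrow> nat \<Rightarrow> real" where
  "alpha_closed p j = (\<Prod>l=0..j. ((real l)\<^sup>2 - p\<^sup>2)) / fact (2 * j + 2)"

text \<open>Up to the sign \<open>(-1)^(j+1)\<close>, the product on the right is \<open>p\<close>
  times the \<open>2 * j + 1\<close> consecutive factors from \<open>p - j\<close> to
  \<open>p + j\<close>. Raising both \<open>p\<close> and \<open>j\<close> by one keeps the lower
  end and adds two factors at the upper end. Multiplying by \<open>p\<close> avoids a
  division.\<close>

lemma prod_square_diff_shift: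
  fixes p :: real
  shows "p * (\<Prod>l=0..Suc j. ((real l)\<^sup>2 - (p + 1)\<^sup>2)) =
    - ((p + 1) * (p + real j + 1) * (p + real j + 2)) * (\<Prod>l=0..j. ((real l)\<^sup>2 - p\<^sup>2))"
proof (induction j)
  case 0
  show ?case by (simp add: power2_eq_square algebra_simps)
next
  case (Suc j)
  let ?P = "\<lambda>p j. \<Prod>l=0..j. ((real l)\<^sup>2 - p\<^sup>2)"
  have "p * ?P (p + 1) (Suc (Suc j)) = p * ?P (p + 1) (Suc j) * ((real (Suc (Suc j)))\<^sup>2 - (p + 1)\<^sup>2)"
    by simp
  also have "\<dots> = - ((p + 1) * (p + real j + 1) * (p + real j + 2)) * ?P p j
      * ((real (Suc (Suc j)))\<^sup>2 - (p + 1)\<^sup>2)"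
    by (simp only: Suc.IH)
  also have "\<dots> = - ((p + 1) * (p + real j + 2) * (p + real j + 3)) *
      (?P p j * ((real (Suc j))\<^sup>2 - p\<^sup>2))"
    by (simp add: power2_eq_square algebra_simps)
  also have "?P p j * ((real (Suc j))\<^sup>2 - p\<^sup>2) = ?P p (Suc j)"
    by simp
  finally show ?case
    by (simp add: add_ac)
qed

text \<open>The second difference in \<open>p\<close> of the longer product is a constant multiple
  of the shorter one, and that constant is absorbed by the quotient of the two factorials.\<close>

lemma alpha_closed_rec:
  assumes "p \<noteq> 0"
  shows "alpha_closed (p + 1) (Suc j) =
    2 * alpha_closed p (Suc j) - alpha_closed (p - 1) (Suc j) - alpha_closed p j"
proof -
  let ?P = "\<lambda>p j. \<Prod>l=0..j. ((real l)\<^sup>2 - p\<^sup>2)"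
  have up: "p * ?P (p + 1) (Suc j) = - ((p + 1) * (p + real j + 1) * (p + real j + 2)) * ?P p j"
    by (rule prod_square_diff_shift)
  \<comment> \<open>The products depend on \<open>p\<close> only through its square, so the downward
    shift is the upward shift taken at \<open>- p\<close>; this is why \<open>p\<close> is
    real.\<close>
  have "(- p + 1)\<^sup>2 = (p - 1)\<^sup>2"
    by (simp add: power2_eq_square algebra_simps)
  then have down: "p * ?P (p - 1) (Suc j) =
      - ((p - 1) * (p - real j - 1) * (p - real j - 2)) * ?P p j"
    using prod_square_diff_shift[of "- p" j] by (simp add: algebra_simps)
  have "p * (?P (p + 1) (Suc j) - 2 * ?P p (Suc j) + ?P (p - 1) (Suc j)) =
      p * ?P (p + 1) (Suc j) - 2 * p * (?P p j * ((real (Suc j))\<^sup>2 - p\<^sup>2)) + p * ?P (p - 1) (Suc j)"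
    by (simp add: algebra_simps)
  also have "\<dots> = p * (- (2 * real j + 4) * (2 * real j + 3) * ?P p j)"
    unfolding up down by (simp add: power2_eq_square algebra_simps)
  finally have second_difference: "?P (p + 1) (Suc j) - 2 * ?P p (Suc j) + ?P (p - 1) (Suc j) =
      - (2 * real j + 4) * (2 * real j + 3) * ?P p j"
    using assms by (simp only: mult_cancel_left) simp
  have f: "fact (2 * Suc j + 2) = (2 * real j + 4) * (2 * real j + 3) * fact (2 * j + 2)"
    by (simp add: algebra_simps)
  have nz: "(2 * real j + 4) * (2 * real j + 3) \<noteq> 0"
    by (simp add: add_nonneg_eq_0_iff)
  have "alpha_closed p j = (2 * real j + 4) * (2 * real j + 3) * ?P p j / fact (2 * Suc j + 2)"
    unfolding alpha_closed_def f using nz by simp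
  also have "(2 * real j + 4) * (2 * real j + 3) * ?P p j =
      2 * ?P p (Suc j) - ?P (p + 1) (Suc j) - ?P (p - 1) (Suc j)"
    using second_difference by linarith
  finally show ?thesis
    unfolding alpha_closed_def by (simp only: diff_divide_distrib)
qed

text \<open>The factor at \<open>l = p\<close> vanishes, in agreement with the value of
  \<open>alpha\<close> there.\<close>

lemma alpha_closed_eq_0: "p \<le> j \<Longrightarrow> alpha_closed (real p) j = 0"
  unfolding alpha_closed_def by auto

lemma alpha_eq_0: "j = 0 \<or> p \<le> j \<Longrightarrow> alpha p j = 0"
  by (subst alpha.simps) auto

text \<open>
  The out-of-range values 0 are consistent with the recursion, so its cases collapse into one, valid
  already from $q = 1$.
\<close>

lemma alpha_rec:
  "alpha (Suc (Suc n)) (Suc j) =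
    (if j = 0 then (real (Suc n))\<^sup>2 / 2 else 0) + 2 * alpha (Suc n) (Suc j) - alpha n (Suc j)
      - alpha (Suc n) j"
proof (cases "n < 2")
  case True
  then consider "n = 0" | "n = 1" by linarith
  then show ?thesis
  proof cases
    case 1
    then show ?thesis
      using alpha_base by (cases "j = 0") (simp_all add: alpha_eq_0 numeral_2_eq_2)
  next
    case 2
    consider "j = 0" | "j = 1" | "j \<ge> 2" by linarith
    then show ?thesis
      using alpha_base 2 by cases (simp_all add: alpha_eq_0 numeral_2_eq_2 numeral_3_eq_3)
  qed
next
  case False
  then have q: "Suc n \<ge> 3" by simp
  \<comment> \<open>With \<open>q = Suc n\<close> and index \<open>Suc j\<close>: first, middle,
    penultimate, last, out of range.\<close>
  consider "j = 0" | "1 \<le> j" "Suc j \<le> n - 1" | "1 \<le> j" "Suc j = n" | "j = n" "1 \<le> j" | "j > n"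
    using False by linarith
  then show ?thesis
  proof cases
    case 1
    then show ?thesis using alpha_rec_first[OF q] by (simp add: alpha_eq_0)
  next
    case 2
    then show ?thesis using alpha_rec_middle[OF q, of "Suc j"] by simp
  next
    case 3
    then have "Suc n - 2 = j" by simp
    with 3 show ?thesis using alpha_rec_penultimate[OF q] by (simp add: alpha_eq_0)
  next
    case 4
    then show ?thesis using alpha_rec_last[OF q] by (simp add: alpha_eq_0)
  next
    case 5
    then show ?thesis by (simp add: alpha_eq_0)
  qed
qed

lemma alpha_eq_alpha_closed: "alpha p (Suc j) = alpha_closed (real p) (Suc j)"
proof (induction p arbitrary: j rule: induct_nat_012)
  case 0
  show ?case using alpha_closed_eq_0[of 0 "Suc j"] by (simp add: alpha_eq_0)
next
  case 1
  show ?case using alpha_closed_eq_0[of 1 "Suc j"] by (simp add: alpha_eq_0)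
next
  case (ge2 n)
  have rec: "alpha_closed (real (Suc (Suc n))) (Suc j) =
      2 * alpha_closed (real (Suc n)) (Suc j) - alpha_closed (real n) (Suc j)
        - alpha_closed (real (Suc n)) j"
    using alpha_closed_rec[of "real (Suc n)" j] by (simp add: add_ac)
  show ?case
  \<comment> \<open>At index 0 the two families differ: \<open>alpha\<close> is 0 there, the closed
    form is not. Its value supplies exactly the inhomogeneous term of
    \<open>alpha_rec\<close>.\<close>
  proof (cases j)
    case 0
    have "alpha_closed (real (Suc n)) 0 = - (real (Suc n))\<^sup>2 / 2"
      by (simp add: alpha_closed_def numeral_2_eq_2)
    then show ?thesis
      unfolding rec alpha_rec ge2.IH unfolding 0 by (simp add: alpha_eq_0)
  next
    case (Suc i)
    then show ?thesis
      unfolding rec alpha_rec by (simp add: ge2.IH)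
  qed
qed

section \<open>Generating polynomials and the cosine identity\<close>

definition alpha_gen :: "nat \<Rightarrow> real \<Rightarrow> real" where
  "alpha_gen p x = (\<Sum>j<p. alpha p (Suc j) * x ^ j)"

text \<open>Brings polynomials with different \<open>p\<close> to a common summation range.\<close>

lemma alpha_gen_eq:
  assumes "p \<le> n"
  shows "alpha_gen p x = (\<Sum>j<n. alpha p (Suc j) * x ^ j)"
  unfolding alpha_gen_def
  by (rule sum.mono_neutral_left) (use assms in \<open>auto simp: alpha_eq_0\<close>)

lemma alpha_gen_0: "alpha_gen 0 x = 0"
  by (simp add: alpha_gen_def)

lemma alpha_gen_1: "alpha_gen (Suc 0) x = 0"
  by (simp add: alpha_gen_def alpha_eq_0)

lemma alpha_gen_rec:
  "alpha_gen (Suc (Suc n)) x =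
    (real (Suc n))\<^sup>2 / 2 + 2 * alpha_gen (Suc n) x - alpha_gen n x - x * alpha_gen (Suc n) x"
proof -
  have first: "(\<Sum>j<Suc (Suc n). (if j = 0 then (real (Suc n))\<^sup>2 / 2 else 0) * x ^ j) =
      (real (Suc n))\<^sup>2 / 2"
    by (subst sum.lessThan_Suc_shift) simp
  have shift: "(\<Sum>j<Suc (Suc n). alpha (Suc n) j * x ^ j) = x * alpha_gen (Suc n) x"
    by (subst sum.lessThan_Suc_shift)
       (simp add: alpha_gen_def alpha_eq_0 sum_distrib_left mult_ac)
  have "alpha_gen (Suc (Suc n)) x =
      (\<Sum>j<Suc (Suc n). (if j = 0 then (real (Suc n))\<^sup>2 / 2 else 0) * x ^ j
        + 2 * (alpha (Suc n) (Suc j) * x ^ j) - alpha n (Suc j) * x ^ j - alpha (Suc n) j * x ^ j)"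
    unfolding alpha_gen_def alpha_rec by (rule sum.cong) (auto simp: algebra_simps)
  also have "\<dots> = (real (Suc n))\<^sup>2 / 2 + 2 * alpha_gen (Suc n) x - alpha_gen n x
      - x * alpha_gen (Suc n) x"
    unfolding sum_subtractf sum.distrib first shift sum_distrib_left[symmetric]
    by (subst (1 2) alpha_gen_eq[where n = "Suc (Suc n)"]) simp_all
  finally show ?thesis .
qed

text \<open>Both sides satisfy \<open>c (q + 1) = (2 - x) * c q - c (q - 1)\<close>. The right side
  is the Chebyshev polynomial of \<open>cos \<theta>\<close> expanded at \<open>x = 0\<close>, with
  \<open>alpha_gen\<close> collecting the terms of degree at least 2.\<close>

lemma cos_eq_alpha_gen:
  assumes "x = 2 - 2 * cos \<theta>"
  shows "cos (real q * \<theta>) = 1 - (real q)\<^sup>2 * x / 2 + x\<^sup>2 * alpha_gen q x"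
proof (induction q rule: induct_nat_012)
  case 0
  show ?case by (simp add: alpha_gen_0)
next
  case 1
  show ?case using assms by (simp add: alpha_gen_1 field_simps)
next
  case (ge2 n)
  have "real (Suc (Suc n)) * \<theta> = real (Suc n) * \<theta> + \<theta>" "real n * \<theta> = real (Suc n) * \<theta> - \<theta>"
    by (simp_all add: algebra_simps)
  then have "cos (real (Suc (Suc n)) * \<theta>) =
      2 * cos \<theta> * cos (real (Suc n) * \<theta>) - cos (real n * \<theta>)"
    by (simp only: cos_add cos_diff) simp
  also have "2 * cos \<theta> = 2 - x"
    using assms by simp
  finally show ?case
    unfolding ge2.IH alpha_gen_rec by (simp add: field_simps power2_eq_square)
qed

lemma alpha_gen_kernel_nonneg:
  assumes "0 \<le> x" "x \<le> 4"
  shows "x * alpha_gen q x \<le> (real q)\<^sup>2 / 2"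
proof (cases "x = 0")
  case False
  \<comment> \<open>The range \<open>0 \<le> x \<le> 4\<close> places the argument of
    \<open>arccos\<close> in [-1, 1].\<close>
  define \<theta> where "\<theta> = arccos (1 - x / 2)"
  have "x = 2 - 2 * cos \<theta>"
    unfolding \<theta>_def using assms by (subst cos_arccos) auto
  from cos_eq_alpha_gen[OF this, of q] cos_le_one[of "real q * \<theta>"]
  have "x\<^sup>2 * alpha_gen q x \<le> (real q)\<^sup>2 * x / 2"
    by linarith
  then have "x * (x * alpha_gen q x) \<le> x * ((real q)\<^sup>2 / 2)"
    by (simp add: power2_eq_square mult_ac)
  with False assms show ?thesis
    by (simp add: mult_le_cancel_left_pos)
qed simp

text \<open>Values and first differences are bounded together so that the induction closes. The
  bound on the difference is the sum of \<open>k^2 / 2\<close> over \<open>k \<le> q\<close>;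
  summing these bounds gives the one on the value.\<close>

lemma alpha_gen_bounds:
  assumes "0 \<le> x" "x \<le> 4"
  shows "0 \<le> alpha_gen q x \<and> alpha_gen q x \<le> (real q)\<^sup>2 * ((real q)\<^sup>2 - 1) / 24
    \<and> 0 \<le> alpha_gen (Suc q) x - alpha_gen q x
    \<and> alpha_gen (Suc q) x - alpha_gen q x \<le> real q * (real q + 1) * (2 * real q + 1) / 12"
proof (induction q)
  case 0
  show ?case by (simp add: alpha_gen_0 alpha_gen_1)
next
  case (Suc q)
  have nonneg: "0 \<le> alpha_gen (Suc q) x"
    using Suc.IH by linarith
  then have xnonneg: "0 \<le> x * alpha_gen (Suc q) x"
    using assms by simp
  have kernel: "x * alpha_gen (Suc q) x \<le> (real (Suc q))\<^sup>2 / 2"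
    using alpha_gen_kernel_nonneg[OF assms] .
  \<comment> \<open>Here \<open>kernel\<close> keeps the new difference nonnegative, and
    \<open>xnonneg\<close> limits its increase to \<open>(Suc q)^2 / 2\<close>.\<close>
  have diff: "alpha_gen (Suc (Suc q)) x - alpha_gen (Suc q) x =
      (alpha_gen (Suc q) x - alpha_gen q x) + (real (Suc q))\<^sup>2 / 2 - x * alpha_gen (Suc q) x"
    by (simp add: alpha_gen_rec)
  have upper: "(real (Suc q))\<^sup>2 * ((real (Suc q))\<^sup>2 - 1) / 24 =
      (real q)\<^sup>2 * ((real q)\<^sup>2 - 1) / 24 + real q * (real q + 1) * (2 * real q + 1) / 12"
    by (simp add: field_simps power2_eq_square)
  have upper_diff: "real (Suc q) * (real (Suc q) + 1) * (2 * real (Suc q) + 1) / 12 =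
      real q * (real q + 1) * (2 * real q + 1) / 12 + (real (Suc q))\<^sup>2 / 2"
    by (simp add: field_simps power2_eq_square)
  show ?case
    unfolding diff upper upper_diff using Suc.IH nonneg xnonneg kernel by linarith
qed

lemma sum_alpha_eq_alpha_gen:
  assumes "p \<ge> 1"
  shows "(\<Sum>j=1..p - 1. alpha p j * x ^ (j - 1)) = alpha_gen p x"
    and "(\<Sum>j=1..p - 1. alpha p j * x ^ j) = x * alpha_gen p x"
proof -
  obtain n where n: "p = Suc n"
    using assms by (cases p) auto
  have gen: "alpha_gen p x = (\<Sum>j<n. alpha p (Suc j) * x ^ j)"
    unfolding alpha_gen_def n by (simp add: alpha_eq_0)
  show "(\<Sum>j=1..p - 1. alpha p j * x ^ (j - 1)) = alpha_gen p x"
    unfolding gen unfolding n by (simp add: sum.atLeast1_atMost_eq)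
  show "(\<Sum>j=1..p - 1. alpha p j * x ^ j) = x * alpha_gen p x"
    unfolding gen unfolding n by (simp add: sum.atLeast1_atMost_eq sum_distrib_left mult_ac)
qed

theorem lemma19:
  shows "(\<forall>p::nat. p \<ge> 2 \<longrightarrow> (\<forall>j\<in>{1..p - 1}.
            alpha p j = (\<Prod>l=0..j. ((real l)\<^sup>2 - (real p)\<^sup>2)) / fact (2 * j + 2)))
       \<and> (\<forall>p::nat. p \<ge> 2 \<longrightarrow> (\<forall>\<kappa>::real. \<kappa> \<in> {0..4 * (real p)\<^sup>2} \<longrightarrow>
            \<bar>2 / (real p)\<^sup>2 * (\<Sum>j=1..p - 1. alpha p j * (\<kappa> / (real p)\<^sup>2) ^ j)\<bar> \<le> \<kappa> / 12
          \<and> \<bar>2 / (real p)\<^sup>2 * (\<Sum>j=1..p - 1. alpha p j * (\<kappa> / (real p)\<^sup>2) ^ (j - 1))\<bar>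
              \<le> ((real p)\<^sup>2 - 1) / 12))"
proof (intro conjI allI ballI impI)
  fix p j :: nat
  assume "j \<in> {1..p - 1}"
  then obtain i where "j = Suc i" by (cases j) auto
  then show "alpha p j = (\<Prod>l=0..j. ((real l)\<^sup>2 - (real p)\<^sup>2)) / fact (2 * j + 2)"
    using alpha_eq_alpha_closed[of p i] by (simp only: alpha_closed_def)
next
  fix p :: nat and \<kappa> :: real
  assume p: "p \<ge> 2" and \<kappa>: "\<kappa> \<in> {0..4 * (real p)\<^sup>2}"
  define x where "x = \<kappa> / (real p)\<^sup>2"
  have p0: "0 < (real p)\<^sup>2" using p by simp
  have x: "0 \<le> x" "x \<le> 4"
    using \<kappa> p0 by (auto simp: x_def pos_divide_le_eq)
  have nonneg: "0 \<le> 2 / (real p)\<^sup>2 * alpha_gen p x"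
    using alpha_gen_bounds[OF x, of p] by simp
  have "2 / (real p)\<^sup>2 * alpha_gen p x \<le> 2 / (real p)\<^sup>2 * ((real p)\<^sup>2 * ((real p)\<^sup>2 - 1) / 24)"
    using alpha_gen_bounds[OF x, of p] by (intro mult_left_mono) auto
  also have "\<dots> = ((real p)\<^sup>2 - 1) / 12"
    using p0 by simp
  finally have le: "2 / (real p)\<^sup>2 * alpha_gen p x \<le> ((real p)\<^sup>2 - 1) / 12" .
  show "\<bar>2 / (real p)\<^sup>2 * (\<Sum>j=1..p - 1. alpha p j * (\<kappa> / (real p)\<^sup>2) ^ (j - 1))\<bar>
      \<le> ((real p)\<^sup>2 - 1) / 12"
    using p nonneg le by (simp only: sum_alpha_eq_alpha_gen x_def[symmetric])
  \<comment> \<open>The first estimate follows from the second by multiplying with \<open>x\<close>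
    and dropping the \<open>- 1\<close>.\<close>
  have "x * (2 / (real p)\<^sup>2 * alpha_gen p x) \<le> x * ((real p)\<^sup>2 / 12)"
    using le x by (intro mult_left_mono) auto
  also have "\<dots> = \<kappa> / 12"
    using p0 by (simp add: x_def)
  finally have "x * (2 / (real p)\<^sup>2 * alpha_gen p x) \<le> \<kappa> / 12" .
  moreover have "0 \<le> x * (2 / (real p)\<^sup>2 * alpha_gen p x)"
    by (rule mult_nonneg_nonneg[OF x(1) nonneg])
  moreover have "2 / (real p)\<^sup>2 * (\<Sum>j=1..p - 1. alpha p j * (\<kappa> / (real p)\<^sup>2) ^ j) =
      x * (2 / (real p)\<^sup>2 * alpha_gen p x)"
    using p by (simp only: sum_alpha_eq_alpha_gen(2) x_def[symmetric]) simp
  ultimately show "\<bar>2 / (real p)\<^sup>2 * (\<Sum>j=1..p - 1. alpha p j * (\<kappa> / (real p)\<^sup>2) ^ j)\<bar> \<le> \<kappa> / 12"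
    by linarith
qed

end
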